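(* Let $\mathbb{F}$ be a finite field of order $q$, let $n\ge 0$ be an integer, and let $\theta$ be a non-trivial additive character of $\mathbb{F}$. Let $\varPhi_n$ be the canonical matrix of the pair $(\mathbb{F}^n,(\mathbb{F}^\times)^n\rtimes\mathfrak{S}_n)$. Then for all $s,r\in\{0,1,\dots,n\}$, $$\varPhi_n(s,r)=(q-1)^r\binom{n}{r}\,K_s\!\left(r;\tfrac{q-1}{q},n\right),$$ where $K_s(r;p,n)$ denotes the Krawtchouk polynomial.
   Context: For $a=(a_1,\dots,a_n)\in\mathbb{F}^n$ let $\operatorname{wt}a=\sharp\{i: a_i\neq 0\}$, and for $a,b\in\mathbb{F}^n$ let $\langle a|b\rangle=\sum_j a_jb_j$. The group $(\mathbb{F}^\times)^n\rtimes\mathfrak{S}_n$ acts on $\mathbb{F}^n$ by $\rho(c,\sigma)a=(c_1a_{\sigma^{-1}(1)},\dots,c_na_{\sigma^{-1}(n)})$; its orbits are $\mathcal{O}(r)=\{a:\operatorname{wt}a=r\}$, $0\le r\le n$. Via $a\mapsto\theta_a$, $\theta_a(b)=\theta(\langle a|b\rangle)$, the orbits on the character group of $\mathbb{F}^n$ are $\{\theta_a:\operatorname{wt}a=s\}$, $0\le s\le n$. The canonical matrix is $$\varPhi_n(s,r)=\sum_{b\in\mathbb{F}^n,\ \operatorname{wt}b=r}\overline{\theta(\langle a|b\rangle)},\qquad a\in\mathbb{F}^n\text{ any element with }\operatorname{wt}a=s$$ (independent of the choice of $a$). For $n=0$, $\mathbb{F}^0=0$ and $\varPhi_0(0,0)=1$.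 Krawtchouk polynomial: for integers $0\le y\le N$ and a parameter $p$, $$K_y(x;p,N)=\sum_{k=0}^y\frac{(-y)_k(-x)_k}{(-N)_k\,k!\,p^k},\qquad (a)_k=a(a+1)\cdots(a+k-1),\ (a)_0=1.$$ *)

theory Defs
  imports
    Complex_Main
    "HOL-Library.FuncSet"
    "HOL-Library.Cardinality"
    "HOL-Combinatorics.Permutations"
begin

text \<open>The space \<open>F^n\<close> consists of the extensional functions on \<open>{1..n}\<close>, so that \<open>n = 0\<close> is allowed
  and gives exactly one vector.\<close>

definition vec_space :: "nat \<Rightarrow> (nat \<Rightarrow> 'a) set" where
  "vec_space n = {1..n} \<rightarrow>\<^sub>E UNIV"

definition wt :: "nat \<Rightarrow> (nat \<Rightarrow> 'a::zero) \<Rightarrow> nat" where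
  "wt n a = card {i \<in> {1..n}. a i \<noteq> 0}"

definition pairing :: "nat \<Rightarrow> (nat \<Rightarrow> 'a) \<Rightarrow> (nat \<Rightarrow> 'a) \<Rightarrow> 'a::comm_semiring_0" where
  "pairing n a b = (\<Sum>j=1..n. a j * b j)"

definition wt_orbit :: "nat \<Rightarrow> nat \<Rightarrow> (nat \<Rightarrow> 'a::zero) set" where
  "wt_orbit n r = {a \<in> vec_space n. wt n a = r}"

definition additive_character :: "('a::ab_group_add \<Rightarrow> complex) \<Rightarrow> bool" where
  "additive_character \<theta> \<longleftrightarrow> (\<forall>x y. \<theta> (x + y) = \<theta> x * \<theta> y) \<and> (\<forall>x. norm (\<theta> x) = 1)"

definition nontrivial_character :: "('a \<Rightarrow> complex) \<Rightarrow> bool" where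
  "nontrivial_character \<theta> \<longleftrightarrow> (\<exists>x. \<theta> x \<noteq> 1)"

text \<open>The choice of \<open>a\<close> is immaterial, see \<open>canonical_matrix_eq\<close> below.\<close>

definition canonical_matrix ::
    "('a::{field,finite} \<Rightarrow> complex) \<Rightarrow> nat \<Rightarrow> nat \<Rightarrow> nat \<Rightarrow> complex" where
  "canonical_matrix \<theta> n s r =
     (let a = (SOME a. a \<in> wt_orbit n s)
      in \<Sum>b \<in> wt_orbit n r. cnj (\<theta> (pairing n a b)))"

text \<open>In \<open>krawtchouk y x p N\<close> the degree \<open>y\<close> is meant to satisfy \<open>y \<le> N\<close>; otherwise some
  \<open>pochhammer (- N) k\<close> vanishes.\<close>

definition krawtchouk :: "nat \<Rightarrow> 'a \<Rightarrow> 'a \<Rightarrow> nat \<Rightarrow> 'a::field_char_0" where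
  "krawtchouk y x p N =
     (\<Sum>k=0..y. (pochhammer (- of_nat y) k * pochhammer (- x) k) /
                (pochhammer (- of_nat N) k * fact k * p ^ k))"


text \<open>The remaining facts relate the sets \<open>wt_orbit n r\<close> and the matrix to the action \<open>\<rho>\<close> of the
  monomial group. A group element is given by its scalars \<open>c\<close>, nonzero on \<open>{1..n}\<close>, and a
  permutation \<open>\<sigma>\<close> of \<open>{1..n}\<close>.\<close>

definition monomial_act ::
    "nat \<Rightarrow> (nat \<Rightarrow> 'a) \<Rightarrow> (nat \<Rightarrow> nat) \<Rightarrow> (nat \<Rightarrow> 'a) \<Rightarrow> (nat \<Rightarrow> 'a::field)" where
  "monomial_act n c \<sigma> a = (\<lambda>i\<in>{1..n}. c i * a (inv \<sigma> i))"

definition monomial_group :: "nat \<Rightarrow> ((nat \<Rightarrow> 'a::field) \<times> (nat \<Rightarrow> nat)) set" where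
  "monomial_group n = {(c, \<sigma>). (\<forall>i\<in>{1..n}. c i \<noteq> 0) \<and> \<sigma> permutes {1..n}}"

lemma finite_vec_space: "finite (vec_space n :: (nat \<Rightarrow> 'a::finite) set)"
  unfolding vec_space_def by (intro finite_PiE) auto

lemma monomial_act_vec_space: "monomial_act n c \<sigma> a \<in> vec_space n"
  by (simp add: monomial_act_def vec_space_def)

lemma wt_monomial_act:
  assumes "(c, \<sigma>) \<in> monomial_group n"
  shows "wt n (monomial_act n c \<sigma> a) = wt n a"
proof -
  have p: "\<sigma> permutes {1..n}" and c: "\<And>i. i \<in> {1..n} \<Longrightarrow> c i \<noteq> 0"
    using assms by (auto simp: monomial_group_def)
  have "{i \<in> {1..n}. monomial_act n c \<sigma> a i \<noteq> 0} = {i \<in> {1..n}. a (inv \<sigma> i) \<noteq> 0}"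
    using c by (auto simp: monomial_act_def)
  also have "\<dots> = \<sigma> ` {i \<in> {1..n}. a i \<noteq> 0}"
  proof (intro equalityI subsetI)
    fix i assume i: "i \<in> {i \<in> {1..n}. a (inv \<sigma> i) \<noteq> 0}"
    have "inv \<sigma> i \<in> {1..n}" using i permutes_in_image[OF permutes_inv[OF p]] by blast
    moreover have "i = \<sigma> (inv \<sigma> i)" using permutes_inverses(1)[OF p] by simp
    ultimately show "i \<in> \<sigma> ` {i \<in> {1..n}. a i \<noteq> 0}" using i by blast
  next
    fix i assume "i \<in> \<sigma> ` {i \<in> {1..n}. a i \<noteq> 0}"
    then obtain j where j: "j \<in> {1..n}" "a j \<noteq> 0" "i = \<sigma> j" by blast
    have "\<sigma> j \<in> {1..n}" using j(1) permutes_in_image[OF p] by blast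
    then show "i \<in> {i \<in> {1..n}. a (inv \<sigma> i) \<noteq> 0}"
      using j permutes_inverses(2)[OF p] by simp
  qed
  finally show ?thesis
    unfolding wt_def using card_image[OF inj_on_subset[OF permutes_inj[OF p] subset_UNIV]] by metis
qed

lemma monomial_act_transitive:
  fixes a b :: "nat \<Rightarrow> 'a::field"
  assumes "b \<in> vec_space n" "wt n b = wt n a"
  shows "\<exists>c \<sigma>. (c, \<sigma>) \<in> monomial_group n \<and> b = monomial_act n c \<sigma> a"
proof -
  define A where "A = {i \<in> {1..n}. a i \<noteq> 0}"
  define B where "B = {i \<in> {1..n}. b i \<noteq> 0}"
  have sub: "A \<subseteq> {1..n}" "B \<subseteq> {1..n}" by (auto simp: A_def B_def)
  have fin: "finite A" "finite B" using sub finite_subset by blast+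
  have card: "card A = card B" using assms(2) by (simp add: A_def B_def wt_def)
  obtain f where f: "bij_betw f A B"
    using finite_same_card_bij[OF fin card] by blast
  have "card ({1..n} - A) = card ({1..n} - B)"
    using card sub fin by (simp add: card_Diff_subset)
  then obtain g where g: "bij_betw g ({1..n} - A) ({1..n} - B)"
    using finite_same_card_bij[of "{1..n} - A" "{1..n} - B"] by auto
  define \<sigma> where "\<sigma> i = (if i \<in> A then f i else if i \<in> {1..n} then g i else i)" for i
  have 1: "bij_betw \<sigma> A B"
    using f by (rule bij_betw_cong[THEN iffD1, rotated]) (simp add: \<sigma>_def)
  have 2: "bij_betw \<sigma> ({1..n} - A) ({1..n} - B)"
    using g by (rule bij_betw_cong[THEN iffD1, rotated]) (simp add: \<sigma>_def)
  have "bij_betw \<sigma> (A \<union> ({1..n} - A)) (B \<union> ({1..n} - B))"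
    using 1 2 by (rule bij_betw_combine) auto
  moreover have "A \<union> ({1..n} - A) = {1..n}" "B \<union> ({1..n} - B) = {1..n}" using sub by auto
  ultimately have bij: "bij_betw \<sigma> {1..n} {1..n}" by simp
  have p: "\<sigma> permutes {1..n}"
    using bij by (rule bij_imp_permutes) (use sub in \<open>auto simp: \<sigma>_def\<close>)
  have inA: "inv \<sigma> i \<in> A \<longleftrightarrow> i \<in> B" if "i \<in> {1..n}" for i
  proof -
    have in_n: "inv \<sigma> i \<in> {1..n}" using that permutes_in_image[OF permutes_inv[OF p]] by blast
    have eq: "\<sigma> (inv \<sigma> i) = i" using permutes_inverses(1)[OF p] .
    show ?thesis
    proof (cases "inv \<sigma> i \<in> A")
      case True
      then have "\<sigma> (inv \<sigma> i) \<in> B" using 1 bij_betwE by blast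
      then show ?thesis using True eq by simp
    next
      case False
      then have "\<sigma> (inv \<sigma> i) \<in> {1..n} - B" using 2 bij_betwE in_n by blast
      then show ?thesis using False eq by simp
    qed
  qed
  have in_n: "inv \<sigma> i \<in> {1..n}" if "i \<in> {1..n}" for i
    using that permutes_in_image[OF permutes_inv[OF p]] by blast
  define c where "c i = (if i \<in> B then b i / a (inv \<sigma> i) else 1)" for i
  have c: "c i \<noteq> 0" if "i \<in> {1..n}" for i
    using inA[OF that] by (auto simp: c_def A_def B_def)
  have "b i = monomial_act n c \<sigma> a i" for i
  proof (cases "i \<in> {1..n}")
    case True
    show ?thesis
    proof (cases "i \<in> B")
      case True
      then show ?thesis using inA[OF \<open>i \<in> {1..n}\<close>] \<open>i \<in> {1..n}\<close>
        by (simp add: monomial_act_def c_def A_def)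
    next
      case False
      then have "a (inv \<sigma> i) = 0" "b i = 0"
        using inA[OF \<open>i \<in> {1..n}\<close>] in_n[OF \<open>i \<in> {1..n}\<close>] \<open>i \<in> {1..n}\<close> by (auto simp: A_def B_def)
      then show ?thesis using \<open>i \<in> {1..n}\<close> by (simp add: monomial_act_def)
    qed
  next
    case False
    then show ?thesis using assms(1) PiE_arb by (fastforce simp: monomial_act_def vec_space_def)
  qed
  then have "b = monomial_act n c \<sigma> a" by blast
  moreover have "(c, \<sigma>) \<in> monomial_group n" using c p by (auto simp: monomial_group_def)
  ultimately show ?thesis by blast
qed

theorem monomial_orbit:
  fixes a :: "nat \<Rightarrow> 'a::field"
  shows "(\<lambda>(c, \<sigma>). monomial_act n c \<sigma> a) ` monomial_group n = wt_orbit n (wt n a)"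
proof (intro equalityI subsetI)
  fix b :: "nat \<Rightarrow> 'a" assume "b \<in> wt_orbit n (wt n a)"
  then show "b \<in> (\<lambda>(c, \<sigma>). monomial_act n c \<sigma> a) ` monomial_group n"
    using monomial_act_transitive[of b n a] by (force simp: wt_orbit_def)
qed (auto simp: wt_orbit_def monomial_act_vec_space wt_monomial_act)

lemma monomial_adjoint_group:
  assumes "(c, \<sigma>) \<in> monomial_group n"
  shows "(\<lambda>i. c (\<sigma> i), inv \<sigma>) \<in> monomial_group n"
proof -
  have p: "\<sigma> permutes {1..n}" and c: "\<And>i. i \<in> {1..n} \<Longrightarrow> c i \<noteq> 0"
    using assms by (auto simp: monomial_group_def)
  have "c (\<sigma> i) \<noteq> 0" if "i \<in> {1..n}" for i
    using c that permutes_in_image[OF p] by blast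
  then show ?thesis using permutes_inv[OF p] by (auto simp: monomial_group_def)
qed

lemma pairing_monomial_act:
  fixes a b :: "nat \<Rightarrow> 'a::field"
  assumes "(c, \<sigma>) \<in> monomial_group n"
  shows "pairing n (monomial_act n c \<sigma> a) b = pairing n a (monomial_act n (\<lambda>i. c (\<sigma> i)) (inv \<sigma>) b)"
proof -
  have p: "\<sigma> permutes {1..n}" using assms by (auto simp: monomial_group_def)
  have "pairing n (monomial_act n c \<sigma> a) b = (\<Sum>i\<in>{1..n}. c i * a (inv \<sigma> i) * b i)"
    by (simp add: pairing_def monomial_act_def)
  also have "\<dots> = (\<Sum>i\<in>{1..n}. c (\<sigma> i) * a (inv \<sigma> (\<sigma> i)) * b (\<sigma> i))"
    by (rule sum.permute[OF p, unfolded o_def])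
  also have "\<dots> = pairing n a (monomial_act n (\<lambda>i. c (\<sigma> i)) (inv \<sigma>) b)"
    using permutes_inverses(2)[OF p] permutes_inv_inv[OF p]
    by (simp add: pairing_def monomial_act_def mult_ac)
  finally show ?thesis .
qed

lemma bij_betw_monomial_act:
  assumes "(c, \<sigma>) \<in> monomial_group n"
  shows "bij_betw (monomial_act n c \<sigma>) (wt_orbit n r) (wt_orbit n r :: (nat \<Rightarrow> 'a::{field,finite}) set)"
proof -
  have p: "\<sigma> permutes {1..n}" and c: "\<And>i. i \<in> {1..n} \<Longrightarrow> c i \<noteq> 0"
    using assms by (auto simp: monomial_group_def)
  have inj: "inj_on (monomial_act n c \<sigma>) (wt_orbit n r)"
  proof (rule inj_onI)
    fix a b :: "nat \<Rightarrow> 'a"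
    assume ab: "a \<in> wt_orbit n r" "b \<in> wt_orbit n r"
      and eq: "monomial_act n c \<sigma> a = monomial_act n c \<sigma> b"
    have "a i = b i" if "i \<in> {1..n}" for i
    proof -
      have "\<sigma> i \<in> {1..n}" using that permutes_in_image[OF p] by blast
      then show ?thesis
        using fun_cong[OF eq, of "\<sigma> i"] c permutes_inverses(2)[OF p] by (auto simp: monomial_act_def)
    qed
    then show "a = b" using ab unfolding wt_orbit_def vec_space_def by (auto intro: PiE_ext)
  qed
  have sub: "monomial_act n c \<sigma> ` wt_orbit n r \<subseteq> wt_orbit n r"
    using wt_monomial_act[OF assms] by (auto simp: wt_orbit_def monomial_act_vec_space)
  have "finite (wt_orbit n r :: (nat \<Rightarrow> 'a) set)"
    by (simp add: wt_orbit_def finite_vec_space)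
  then show ?thesis using inj endo_inj_surj[OF _ sub inj] by (simp add: bij_betw_def)
qed

theorem character_orbit:
  fixes a :: "nat \<Rightarrow> 'a::field" and \<theta> :: "'a \<Rightarrow> complex"
  shows "(\<lambda>(c, \<sigma>) b. \<theta> (pairing n a (monomial_act n c \<sigma> b))) ` monomial_group n
       = (\<lambda>a' b. \<theta> (pairing n a' b)) ` wt_orbit n (wt n a)"
proof (intro equalityI subsetI)
  fix \<chi> assume "\<chi> \<in> (\<lambda>(c, \<sigma>) b. \<theta> (pairing n a (monomial_act n c \<sigma> b))) ` monomial_group n"
  then obtain c \<sigma> where g: "(c, \<sigma>) \<in> monomial_group n"
    and \<chi>: "\<chi> = (\<lambda>b. \<theta> (pairing n a (monomial_act n c \<sigma> b)))" by auto
  define a' where "a' = monomial_act n (\<lambda>i. c (\<sigma> i)) (inv \<sigma>) a"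
  have sym: "pairing n x y = pairing n y x" for x y :: "nat \<Rightarrow> 'a"
    by (simp add: pairing_def mult.commute)
  have "\<chi> = (\<lambda>b. \<theta> (pairing n a' b))"
    using pairing_monomial_act[OF g, of _ a] sym by (simp add: \<chi> a'_def)
  moreover have "a' \<in> wt_orbit n (wt n a)"
    using wt_monomial_act[OF monomial_adjoint_group[OF g]]
    by (simp add: a'_def wt_orbit_def monomial_act_vec_space)
  ultimately show "\<chi> \<in> (\<lambda>a' b. \<theta> (pairing n a' b)) ` wt_orbit n (wt n a)" by blast
next
  fix \<chi> assume "\<chi> \<in> (\<lambda>a' b. \<theta> (pairing n a' b)) ` wt_orbit n (wt n a)"
  then obtain c \<sigma> where g: "(c, \<sigma>) \<in> monomial_group n"
    and \<chi>: "\<chi> = (\<lambda>b. \<theta> (pairing n (monomial_act n c \<sigma> a) b))"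
    unfolding monomial_orbit[symmetric] by auto
  then show "\<chi> \<in> (\<lambda>(c, \<sigma>) b. \<theta> (pairing n a (monomial_act n c \<sigma> b))) ` monomial_group n"
    by (intro image_eqI[OF _ monomial_adjoint_group[OF g]])
       (simp add: \<chi> pairing_monomial_act[OF g])
qed

theorem canonical_matrix_eq:
  fixes \<theta> :: "'a::{field,finite} \<Rightarrow> complex"
  assumes "a \<in> vec_space n" "wt n a = s"
  shows "canonical_matrix \<theta> n s r = (\<Sum>b \<in> wt_orbit n r. cnj (\<theta> (pairing n a b)))"
proof -
  define a0 :: "nat \<Rightarrow> 'a" where "a0 = (SOME a. a \<in> wt_orbit n s)"
  have "a0 \<in> wt_orbit n s"
    unfolding a0_def using assms by (intro someI[of "\<lambda>a. a \<in> wt_orbit n s" a]) (simp add: wt_orbit_def)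
  then have "a0 \<in> vec_space n" "wt n a0 = s" by (auto simp: wt_orbit_def)
  then obtain c \<sigma> where g: "(c, \<sigma>) \<in> monomial_group n" and a0: "a0 = monomial_act n c \<sigma> a"
    using monomial_act_transitive[of a0 n a] assms by auto
  have "canonical_matrix \<theta> n s r = (\<Sum>b \<in> wt_orbit n r. cnj (\<theta> (pairing n a0 b)))"
    by (simp add: canonical_matrix_def a0_def Let_def)
  also have "\<dots> = (\<Sum>b \<in> wt_orbit n r.
      cnj (\<theta> (pairing n a (monomial_act n (\<lambda>i. c (\<sigma> i)) (inv \<sigma>) b))))"
    by (simp add: a0 pairing_monomial_act[OF g])
  also have "\<dots> = (\<Sum>b \<in> wt_orbit n r. cnj (\<theta> (pairing n a b)))"
    by (rule sum.reindex_bij_betw[OF bij_betw_monomial_act[OF monomial_adjoint_group[OF g]]])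
  finally show ?thesis .
qed

lemma wt_orbit_nonempty:
  assumes "r \<le> n"
  shows "wt_orbit n r \<noteq> ({} :: (nat \<Rightarrow> 'a::zero_neq_one) set)"
proof -
  define a :: "nat \<Rightarrow> 'a" where "a = (\<lambda>i\<in>{1..n}. if i \<le> r then 1 else 0)"
  have "{i \<in> {1..n}. a i \<noteq> 0} = {1..r}" using assms by (auto simp: a_def)
  then have "a \<in> wt_orbit n r" by (simp add: wt_orbit_def wt_def vec_space_def a_def)
  then show ?thesis by blast
qed

end

theory Submission
  imports Defs "HOL-Computational_Algebra.Polynomial"
begin

text \<open>Record the weight of \<open>b\<close> by the exponent of a formal variable \<open>X\<close>. Since the character of a
  sum is a product, the sum over \<open>b\<close> of \<open>cnj (\<theta> \<langle>a|b\<rangle>) X ^ wt b\<close> factors over the coordinates. By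
  orthogonality, a coordinate with \<open>a i \<noteq> 0\<close> contributes \<open>1 - X\<close> and one with \<open>a i = 0\<close> contributes
  \<open>1 + (q - 1) X\<close>, so row \<open>s\<close> of the matrix has generating function
  \<open>(1 - X) ^ s * (1 + (q - 1) X) ^ (n - s)\<close>. Expanding \<open>1 - X = (1 + (q - 1) X) - q X\<close> binomially turns its
  coefficients into the Krawtchouk sum.\<close>

lemma additive_character_0:
  assumes "additive_character \<theta>"
  shows "\<theta> 0 = 1"
proof -
  have "\<theta> 0 * \<theta> 0 = \<theta> 0"
    using assms unfolding additive_character_def by (metis add_0)
  moreover have "norm (\<theta> 0) = 1"
    using assms by (simp add: additive_character_def)
  then have "\<theta> 0 \<noteq> 0" by force
  ultimately show ?thesis by simp
qed

lemma additive_character_sum: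
  assumes "additive_character \<theta>" "finite A"
  shows "\<theta> (sum f A) = (\<Prod>x\<in>A. \<theta> (f x))"
  using assms(2)
  by (induction A rule: finite_induct)
     (use assms(1) additive_character_0 in \<open>auto simp: additive_character_def\<close>)

text \<open>Translation by \<open>y\<close> permutes the group but multiplies the sum by
  \<open>\<theta> y\<close>; choosing \<open>\<theta> y \<noteq> 1\<close> forces the sum to
  vanish.\<close>

lemma sum_nontrivial_character:
  fixes \<theta> :: "'a::{ab_group_add,finite} \<Rightarrow> complex"
  assumes "additive_character \<theta>" "nontrivial_character \<theta>"
  shows "(\<Sum>x\<in>UNIV. \<theta> x) = 0"
proof -
  obtain y where y: "\<theta> y \<noteq> 1" using assms(2) by (auto simp: nontrivial_character_def)
  have "bij ((+) y)" by (rule bij_plus)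
  then have "(\<Sum>x\<in>UNIV. \<theta> x) = (\<Sum>x\<in>UNIV. \<theta> (y + x))"
    by (rule sum.reindex_bij_betw[symmetric])
  also have "\<dots> = \<theta> y * (\<Sum>x\<in>UNIV. \<theta> x)"
    using assms(1) by (simp add: additive_character_def sum_distrib_left)
  finally show ?thesis using y by simp
qed

text \<open>For \<open>c \<noteq> 0\<close>, scaling permutes the field, so the full sum is 0 by
  orthogonality and dropping the term 1 at \<open>x = 0\<close> leaves -1. Zero is left out because
  only nonzero coordinates add to the weight.\<close>

lemma sum_scaled_character_nonzero:
  fixes \<theta> :: "'a::{field,finite} \<Rightarrow> complex"
  assumes "additive_character \<theta>" "nontrivial_character \<theta>"
  shows "(\<Sum>x\<in>UNIV - {0}. \<theta> (c * x)) = (if c = 0 then of_nat CARD('a) - 1 else - 1)"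
proof (cases "c = 0")
  case True
  have "CARD('a) \<ge> 1" by (simp add: Suc_le_eq)
  then show ?thesis using True additive_character_0[OF assms(1)]
    by (simp add: card_Diff_singleton of_nat_diff)
next
  case False
  then have "bij ((*) c)"
    by (intro bij_betwI[where g = "\<lambda>x. x / c"]) auto
  then have "(\<Sum>x\<in>UNIV. \<theta> (c * x)) = (\<Sum>x\<in>UNIV. \<theta> x)"
    by (rule sum.reindex_bij_betw)
  then have "(\<Sum>x\<in>UNIV. \<theta> (c * x)) = 0" using sum_nontrivial_character[OF assms] by simp
  moreover have "(\<Sum>x\<in>UNIV. \<theta> (c * x)) = \<theta> 0 + (\<Sum>x\<in>UNIV - {0}. \<theta> (c * x))"
    by (subst sum.remove[of UNIV 0]) auto
  ultimately show ?thesis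
    using False additive_character_0[OF assms(1)] by (simp add: add_eq_0_iff)
qed

lemma monom_prod: "(\<Prod>x\<in>A. monom (f x) (g x)) = monom (\<Prod>x\<in>A. f x) (\<Sum>x\<in>A. g x)"
  by (induction A rule: infinite_finite_induct) (simp_all add: mult_monom monom_0 one_pCons)

lemma coeff_one_plus_linear_power:
  "coeff ([:1, c:] ^ n) k = of_nat (n choose k) * (c::'a::comm_ring_1) ^ k"
proof -
  have "[:1, c:] ^ n = (monom c 1 + 1) ^ n"
    by (simp add: monom_Suc monom_0 one_pCons)
  also have "\<dots> = (\<Sum>i\<le>n. monom (of_nat (n choose i) * c ^ i) i)"
    by (simp add: binomial_ring monom_power of_nat_monom mult_monom)
  finally show ?thesis by (simp add: coeff_sum binomial_eq_0)
qed

lemma weight_generating_polynomial: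
  fixes \<theta> :: "'a::{field,finite} \<Rightarrow> complex"
  assumes \<theta>: "additive_character \<theta>" "nontrivial_character \<theta>"
  shows "(\<Sum>b\<in>vec_space n. monom (cnj (\<theta> (pairing n a b))) (wt n b)) =
         [:1, -1:] ^ wt n a * [:1, of_nat CARD('a) - 1:] ^ (n - wt n a)"
proof -
  let ?m = "\<lambda>i x. monom (cnj (\<theta> (a i * x))) (of_bool (x \<noteq> 0))"
  let ?A = "{i \<in> {1..n}. a i \<noteq> 0}"
  have factor: "(\<Sum>x\<in>UNIV. ?m i x) = (if a i \<noteq> 0 then [:1, -1:] else [:1, of_nat CARD('a) - 1:])" for i
  proof -
    have "(\<Sum>x\<in>UNIV. ?m i x) = 1 + (\<Sum>x\<in>UNIV - {0}. ?m i x)"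
      by (subst sum.remove[of UNIV 0]) (auto simp: additive_character_0[OF \<theta>(1)] monom_0 one_pCons)
    also have "(\<Sum>x\<in>UNIV - {0}. ?m i x) = monom (cnj (\<Sum>x\<in>UNIV - {0}. \<theta> (a i * x))) 1"
      by (simp add: monom_sum)
    \<comment> \<open>Both possible values of the character sum are real, so the conjugation
      disappears.\<close>
    finally show ?thesis
      unfolding sum_scaled_character_nonzero[OF \<theta>] by (simp add: monom_Suc monom_0 one_pCons)
  qed
  \<comment> \<open>The weight is a sum of indicators of \<open>b i \<noteq> 0\<close>, so character
    value and exponent split over the coordinates together. Distributivity over extensional
    functions then exchanges sum and product.\<close>
  have "monom (cnj (\<theta> (pairing n a b))) (wt n b) = (\<Prod>i\<in>{1..n}. ?m i (b i))" for b
    using \<theta>(1) by (simp add: monom_prod pairing_def wt_def additive_character_sum Int_def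
        sum_of_bool_eq conj_ac)
  then have "(\<Sum>b\<in>vec_space n. monom (cnj (\<theta> (pairing n a b))) (wt n b)) =
        (\<Prod>i\<in>{1..n}. \<Sum>x\<in>UNIV. ?m i x)"
    by (simp add: vec_space_def prod_sum_PiE)
  also have "\<dots> = (\<Prod>i\<in>{1..n}. if a i \<noteq> 0 then [:1, -1:] else [:1, of_nat CARD('a) - 1:])"
    by (simp only: factor)
  also have "\<dots> =
      [:1, -1:] ^ card ?A * [:1, of_nat CARD('a) - 1:] ^ card ({1..n} - ?A)"
    by (subst prod.If_cases) (simp_all add: Int_def set_diff_eq conj_ac cong: conj_cong)
  also have "card ({1..n} - ?A) = n - card ?A"
    by (subst card_Diff_subset) auto
  finally show ?thesis by (simp add: wt_def)
qed

lemma canonical_matrix_eq_coeff: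
  fixes \<theta> :: "'a::{field,finite} \<Rightarrow> complex"
  assumes "additive_character \<theta>" "nontrivial_character \<theta>" and "s \<le> n"
  shows "canonical_matrix \<theta> n s r =
         coeff ([:1, -1:] ^ s * [:1, of_nat CARD('a) - 1:] ^ (n - s)) r"
proof -
  obtain a :: "nat \<Rightarrow> 'a" where a: "a \<in> vec_space n" "wt n a = s"
    using wt_orbit_nonempty[OF assms(3)] by (auto simp: wt_orbit_def)
  have "canonical_matrix \<theta> n s r = (\<Sum>b\<in>wt_orbit n r. cnj (\<theta> (pairing n a b)))"
    using canonical_matrix_eq[OF a] .
  \<comment> \<open>The indicator of weight \<open>r\<close> is exactly what taking the coefficient
    at \<open>r\<close> of each monomial produces.\<close>
  also have "\<dots> = (\<Sum>b\<in>vec_space n. if wt n b = r then cnj (\<theta> (pairing n a b)) else 0)"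
    unfolding wt_orbit_def by (rule sum.inter_filter) (rule finite_vec_space)
  also have "\<dots> = coeff (\<Sum>b\<in>vec_space n. monom (cnj (\<theta> (pairing n a b))) (wt n b)) r"
    by (simp add: coeff_sum)
  finally show ?thesis
    unfolding weight_generating_polynomial[OF assms(1,2)] a(2) .
qed

text \<open>Write 1 - X = -cX + (1 + (c - 1)X) and expand the power \<open>s\<close>. The leftover
  factors 1 + (c - 1)X number (s - k) + (n - s) = n - k.\<close>

lemma coeff_weight_polynomial:
  fixes c :: "'a::comm_ring_1"
  assumes "s \<le> n"
  shows "coeff ([:1, -1:] ^ s * [:1, c - 1:] ^ (n - s)) r =
    (\<Sum>k\<le>s. if k \<le> r then of_nat (s choose k) * (- c) ^ k *
                       (of_nat ((n - k) choose (r - k)) * (c - 1) ^ (r - k)) else 0)"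
proof -
  let ?L = "[:1, c - 1:]"
  have "[:1, -1:] ^ s * ?L ^ (n - s) = (monom (- c) 1 + ?L) ^ s * ?L ^ (n - s)"
    by (simp add: monom_Suc monom_0)
  also have "\<dots> = (\<Sum>k\<le>s. monom (of_nat (s choose k) * (- c) ^ k) k * ?L ^ (s - k) * ?L ^ (n - s))"
    by (simp add: binomial_ring monom_power of_nat_monom mult_monom sum_distrib_right
        del: power_Suc mult_pCons_left mult_pCons_right)
  also have "\<dots> = (\<Sum>k\<le>s. monom (of_nat (s choose k) * (- c) ^ k) k * ?L ^ (n - k))"
    using assms by (intro sum.cong) (auto simp: mult.assoc simp flip: power_add)
  finally show ?thesis
    by (auto simp: coeff_sum coeff_monom_mult coeff_one_plus_linear_power intro!: sum.cong)
qed

lemma pochhammer_neg_of_nat: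
  "pochhammer (- of_nat m :: 'a::field_char_0) k = (-1) ^ k * fact k * of_nat (m choose k)"
  by (simp add: binomial_gbinomial gbinomial_pochhammer flip: power_mult_distrib mult.assoc)

text \<open>The identity holds term by term. After \<open>pochhammer_neg_of_nat\<close>, one sign
  (-1)^k survives, the factorials cancel, and C(n,r) C(r,k) = C(n,k) C(n-k,r-k) removes the
  denominator C(n,k), nonzero since k \<le> s \<le> n. For k > r the factor C(r,k) vanishes.\<close>

lemma binomial_mult_krawtchouk:
  fixes p :: "'a::field_char_0"
  assumes "s \<le> n" "r \<le> n"
  shows "of_nat (n choose r) * krawtchouk s (of_nat r) p n =
    (\<Sum>k\<le>s. if k \<le> r then of_nat (s choose k) * of_nat ((n - k) choose (r - k)) * (- 1 / p) ^ k else 0)"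
proof -
  have "of_nat (n choose r) * (pochhammer (- of_nat s) k * pochhammer (- of_nat r) k /
          (pochhammer (- of_nat n) k * fact k * p ^ k)) =
        (if k \<le> r then of_nat (s choose k) * of_nat ((n - k) choose (r - k)) * (- 1 / p) ^ k else 0)"
    if "k \<le> s" for k
  proof (cases "k \<le> r")
    case True
    have "of_nat (n choose r) * of_nat (r choose k) =
          (of_nat (n choose k) * of_nat ((n - k) choose (r - k)) :: 'a)"
      using choose_mult[OF True assms(2)] by (metis of_nat_mult)
    moreover have "of_nat (n choose k) \<noteq> (0 :: 'a)" using that assms(1) by simp
    ultimately have "of_nat ((n - k) choose (r - k)) =
        (of_nat (n choose r) * of_nat (r choose k) / of_nat (n choose k) :: 'a)"
      by simp
    moreover have "(- 1 / p) ^ k = (-1) ^ k / p ^ k" by (rule power_divide)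
    ultimately show ?thesis
      using True by (simp add: pochhammer_neg_of_nat mult_ac minus_one_power_iff)
  next
    case False
    then show ?thesis by (simp add: pochhammer_neg_of_nat binomial_eq_0)
  qed
  then show ?thesis
    by (simp add: krawtchouk_def sum_distrib_left atLeast0AtMost)
qed

theorem proposition1p0p3:
  fixes \<theta> :: "'a::{field,finite} \<Rightarrow> complex" and n q s r :: nat
  assumes "q = CARD('a)"
    and "additive_character \<theta>" and "nontrivial_character \<theta>"
    and "s \<le> n" and "r \<le> n"
  shows "canonical_matrix \<theta> n s r =
           (of_nat q - 1) ^ r * of_nat (n choose r) *
           krawtchouk s (of_nat r) ((of_nat q - 1) / of_nat q) n"
proof -
  let ?q = "of_nat q :: complex"
  \<comment> \<open>A field has 0 \<noteq> 1, so q is at least 2 and q - 1 can be cancelled.\<close>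
  have "card {0, 1 :: 'a} \<le> q"
    unfolding assms(1) by (rule card_mono) auto
  then have q: "?q - 1 \<noteq> 0" by simp
  \<comment> \<open>Here -1/p = -q/(q - 1), so \<open>k\<close> of the \<open>r\<close> factors q -
    1 cancel the denominator.\<close>
  have power_split: "(?q - 1) ^ r * (- 1 / ((?q - 1) / ?q)) ^ k = (- ?q) ^ k * (?q - 1) ^ (r - k)"
    if "k \<le> r" for k
  proof -
    have "(?q - 1) ^ r = (?q - 1) ^ k * (?q - 1) ^ (r - k)"
      using that by (simp flip: power_add)
    moreover have "(?q - 1) ^ k * (- 1 / ((?q - 1) / ?q)) ^ k = (- ?q) ^ k"
      using q by (simp flip: power_mult_distrib)
    ultimately show ?thesis by (simp add: mult_ac)
  qed
  have "canonical_matrix \<theta> n s r = (\<Sum>k\<le>s. if k \<le> r then of_nat (s choose k) * (- ?q) ^ k *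
      (of_nat ((n - k) choose (r - k)) * (?q - 1) ^ (r - k)) else 0)"
    unfolding canonical_matrix_eq_coeff[OF assms(2-4)] assms(1)
    by (rule coeff_weight_polynomial[OF assms(4)])
  also have "\<dots> = (?q - 1) ^ r * (of_nat (n choose r) * krawtchouk s (of_nat r) ((?q - 1) / ?q) n)"
    unfolding binomial_mult_krawtchouk[OF assms(4,5)] sum_distrib_left
    by (intro sum.cong) (auto simp: mult_ac simp del: power_divide simp flip: power_split)
  finally show ?thesis by (simp only: mult.assoc)
qed

end
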